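(* Let $d\geq 3$, let $\Lambda$ be a full-rank lattice in $\mathbb R^d$ and let $\Lambda^\ast=\{\mathbf y\in\mathbb R^d : \langle\mathbf y,\mathbf x\rangle\in\mathbb Z\text{ for all }\mathbf x\in\Lambda\}$ be its dual lattice. Then \[ \omega(\Lambda)\geq\frac{\omega(\Lambda^\ast)}{(d-1)^2+d(d-2)\,\omega(\Lambda^\ast)}, \] where, if $\omega(\Lambda^\ast)=\infty$, this is to be read as $\omega(\Lambda)\geq\dfrac{1}{d(d-2)}$.
   Context: $\langle\cdot,\cdot\rangle$ is the standard inner product and $|\cdot|$ the sup-norm on $\mathbb R^d$. For $\mathbf x=(x_1,\ldots,x_d)\in\mathbb R^d$ put $\Pi(\mathbf x)=\prod_{1\leq i\leq d}|x_i|^{1/d}$. For a lattice $\Lambda\subset\mathbb R^d$, its Diophantine exponent $\omega(\Lambda)$ is the supremum of real $\gamma$ such that the inequality $\Pi(\mathbf x)\leq|\mathbf x|^{-\gamma}$ has infinitely many solutions $\mathbf x\in\Lambda$ (possibly $+\infty$). *)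

theory Defs
  imports "HOL-Analysis.Analysis"
begin

definition full_rank_lattice :: "(real ^ 'n) set \<Rightarrow> bool" where
  "full_rank_lattice L \<longleftrightarrow>
     (\<exists>B. independent B \<and> span B = UNIV \<and>
          L = {\<Sum>b\<in>B. of_int (c b) *\<^sub>R b | c :: real ^ 'n \<Rightarrow> int. True})"

definition dual_lattice :: "(real ^ 'n) set \<Rightarrow> (real ^ 'n) set" where
  "dual_lattice L = {y. \<forall>x\<in>L. y \<bullet> x \<in> \<int>}"

definition prod_mean :: "real ^ 'n \<Rightarrow> real" where
  "prod_mean x = (\<Prod>i\<in>UNIV. \<bar>x $ i\<bar> powr (1 / real CARD('n)))"

text \<open>
  The sup-norm is \<open>infnorm\<close>. The supremum is taken in the extended reals, since the exponent
  may be infinite. The value of \<open>powr\<close> at base zero only concerns the single point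
  \<open>x = 0\<close>, so it does not affect whether the solution set is infinite.
\<close>
definition dioph_exponent :: "(real ^ 'n) set \<Rightarrow> ereal" where
  "dioph_exponent L =
     Sup {ereal \<gamma> | \<gamma> :: real. infinite {x \<in> L. prod_mean x \<le> infnorm x powr (- \<gamma>)}}"

end

theory Submission
  imports Defs "HOL-Real_Asymp.Real_Asymp"
begin

text \<open>
  Let \<open>y\<close> be a point of the dual lattice with \<open>\<Pi>(y) \<le> Y\<^bsup>-\<gamma>\<^esup>\<close>, where \<open>Y = |y|\<close> is large and
  \<open>\<gamma> > 0\<close>. Enlarging the small \<open>|y\<^sub>i|\<close> to numbers \<open>l\<^sub>i \<le> Y\<close> with \<open>P = \<Prod> l\<^sub>i = Y\<^bsup>-\<gamma>d\<^esup>\<close>, one finds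
  by pigeonhole a nonzero lattice point \<open>x\<close> orthogonal to \<open>y\<close> with
  \<open>|x\<^sub>i| \<le> C P\<^bsup>1/(d-1)\<^esup> / l\<^sub>i\<close>, where \<open>C\<close> depends only on the lattice.
  Hence \<open>\<Pi>(x) \<le> C Y\<^bsup>-\<gamma>/(d-1)\<^esup>\<close>, and since \<open>P \<le> l\<^sub>i Y\<^bsup>d-1\<^esup>\<close> also
  \<open>|x| \<le> C Y\<^bsup>E\<^esup>\<close> with \<open>E = d - 1 + \<gamma>d(d-2)/(d-1)\<close>; the ratio of the two exponents is
  \<open>\<gamma> / ((d-1)\<^sup>2 + d(d-2)\<gamma>)\<close>. The case of a nonpositive dual exponent reduces to
  \<open>\<omega>(\<Lambda>) \<ge> 0\<close>, which is again pigeonhole.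
\<close>

section \<open>Integer spans and pigeonhole for linear forms\<close>

definition int_span :: "(real ^ 'n) set \<Rightarrow> (real ^ 'n) set" where
  "int_span B = {\<Sum>b\<in>B. of_int (c b) *\<^sub>R b | c :: real ^ 'n \<Rightarrow> int. True}"

lemma int_span_of_nat_mult:
  assumes "x \<in> int_span B"
  shows "of_nat n *\<^sub>R x \<in> int_span B"
proof -
  obtain c :: "real ^ 'a \<Rightarrow> int" where "x = (\<Sum>b\<in>B. of_int (c b) *\<^sub>R b)"
    using assms unfolding int_span_def by blast
  then have "of_nat n *\<^sub>R x = (\<Sum>b\<in>B. of_int (int n * c b) *\<^sub>R b)"
    by (simp add: scaleR_sum_right)
  then show ?thesis
    unfolding int_span_def by (auto intro!: exI[of _ "\<lambda>b. int n * c b"])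
qed

lemma floor_in_interval: "\<bar>t\<bar> \<le> m \<Longrightarrow> \<lfloor>t\<rfloor> \<in> {-\<lceil>m\<rceil>..\<lfloor>m\<rfloor>}" for t m :: real
  unfolding atLeastAtMost_iff by linarith

text \<open>A pigeonhole substitute for Minkowski's linear forms theorem, with the cruder factors
  \<open>3 * CARD('n) * K i\<close> in place of a determinant. The \<open>N ^ CARD('n)\<close>
  integer combinations with coefficients in \<open>{0..<N}\<close> outnumber the boxes with sides
  \<open>\<delta> i\<close> that their form values can meet; the difference of two combinations in
  one box is the point sought.\<close>

lemma linear_forms_small:
  fixes f :: "'n::finite \<Rightarrow> real ^ 'n \<Rightarrow> real" and K \<delta> :: "'n \<Rightarrow> real"
  assumes indep: "independent B" and span: "span B = UNIV"
    and lin: "\<And>i. linear (f i)"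
    and K: "\<And>i b. b \<in> B \<Longrightarrow> \<bar>f i b\<bar> \<le> K i" and K_pos: "\<And>i. K i > 0"
    and \<delta>_pos: "\<And>i. \<delta> i > 0"
    and large: "(\<Prod>i\<in>UNIV. 3 * real CARD('n) * K i) < (\<Prod>i\<in>UNIV. \<delta> i)"
  obtains x where "x \<in> int_span B" "x \<noteq> 0" "\<And>i. \<bar>f i x\<bar> < \<delta> i"
proof -
  define d where "d = real CARD('n)"
  have d_pos: "d > 0" by (simp add: d_def)
  have fin: "finite B" using indep by (rule independent_imp_finite)
  have cardB: "card B = CARD('n)"
    using dim_eq_card_independent[OF indep] dim_span[of B] span by simp
  \<comment> \<open>This size of \<open>N\<close> makes every \<open>M i\<close> below at least 2,
    so that the possible floors number at most \<open>2 * M i + 2 \<le> 3 * M i\<close>.\<close>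
  obtain N :: nat where N: "\<And>i. real N \<ge> 2 * \<delta> i / (d * K i)"
  proof -
    obtain N :: nat where N: "real N \<ge> Max (range (\<lambda>i. 2 * \<delta> i / (d * K i)))"
      using real_arch_simple by blast
    have "real N \<ge> 2 * \<delta> i / (d * K i)" for i
      by (rule order_trans[OF Max_ge N]) auto
    then show ?thesis using that by blast
  qed
  \<comment> \<open>\<open>M i\<close> bounds \<open>\<bar>f i (v c)\<bar> / \<delta> i\<close> on
    \<open>D\<close>: the sum has \<open>d\<close> terms, each at most
    \<open>N * K i\<close>.\<close>
  define M where "M i = real N * d * K i / \<delta> i" for i
  have M2: "M i \<ge> 2" for i
    using N[of i] d_pos K_pos[of i] \<delta>_pos[of i] by (simp add: M_def field_simps)
  have N_pos: "N > 0"
    using M2[of undefined] by (cases "N = 0") (auto simp: M_def)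
  define v where "v c = (\<Sum>b\<in>B. of_int (c b) *\<^sub>R b)" for c :: "real ^ 'n \<Rightarrow> int"
  define D where "D = PiE B (\<lambda>_. {0..<int N})"
  define R where "R = PiE UNIV (\<lambda>i. {-\<lceil>M i\<rceil>..\<lfloor>M i\<rfloor>})"
  define h where "h c = (\<lambda>i. \<lfloor>f i (v c) / \<delta> i\<rfloor>)" for c
  have cardD: "card D = N ^ CARD('n)"
    using fin by (simp add: D_def card_PiE cardB)
  have card_interval: "real (card {-\<lceil>M i\<rceil>..\<lfloor>M i\<rfloor>}) \<le> 3 * M i" for i
  proof -
    have "real (card {-\<lceil>M i\<rceil>..\<lfloor>M i\<rfloor>}) = of_int (\<lfloor>M i\<rfloor> + \<lceil>M i\<rceil> + 1)"
      using M2[of i] by simp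
    also have "\<dots> \<le> 3 * M i" using M2[of i] by linarith
    finally show ?thesis .
  qed
  have finR: "finite R" unfolding R_def by (intro finite_PiE) auto
  \<comment> \<open>The factor \<open>N ^ CARD('n)\<close> splits off, and \<open>large\<close>
    makes the remaining quotient less than 1, whatever \<open>N\<close> is.\<close>
  have "real (card R) \<le> (\<Prod>i\<in>UNIV. 3 * M i)"
    unfolding R_def by (simp add: card_PiE del: card_atLeastAtMost_int) (intro prod_mono conjI card_interval, simp)
  also have "\<dots> = (\<Prod>i\<in>UNIV. real N * ((3 * d * K i) / \<delta> i))"
    by (intro prod.cong) (auto simp: M_def)
  also have "\<dots> = real N ^ CARD('n) * ((\<Prod>i\<in>UNIV. 3 * d * K i) / (\<Prod>i\<in>UNIV. \<delta> i))"
    by (simp only: prod.distrib prod_dividef) simp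
  also have "\<dots> < real N ^ CARD('n) * 1"
    using large N_pos \<delta>_pos by (intro mult_strict_left_mono) (auto simp: d_def prod_pos)
  finally have "card R < card D"
    using cardD by (metis mult.right_neutral of_nat_less_iff of_nat_power)
  moreover have "h ` D \<subseteq> R"
  proof
    fix g assume "g \<in> h ` D"
    then obtain c where c: "c \<in> D" and g: "g = h c" by blast
    have "\<bar>f i (v c) / \<delta> i\<bar> \<le> M i" for i
    proof -
      have "f i (v c) = (\<Sum>b\<in>B. of_int (c b) * f i b)"
        unfolding v_def by (simp add: linear_sum[OF lin] linear_cmul[OF lin])
      then have "\<bar>f i (v c)\<bar> \<le> (\<Sum>b\<in>B. \<bar>of_int (c b) * f i b\<bar>)"
        by (simp add: sum_abs)
      also have "\<dots> \<le> (\<Sum>b\<in>B. real N * K i)"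
      proof (rule sum_mono)
        fix b assume b: "b \<in> B"
        then have "0 \<le> c b" "c b < int N" using c by (auto simp: D_def PiE_def Pi_def)
        then have "\<bar>real_of_int (c b)\<bar> \<le> real N" by linarith
        then show "\<bar>of_int (c b) * f i b\<bar> \<le> real N * K i"
          unfolding abs_mult using K[OF b] by (intro mult_mono) auto
      qed
      also have "\<dots> = real N * d * K i" by (simp add: cardB d_def)
      finally show ?thesis
        using \<delta>_pos[of i] by (simp add: M_def abs_divide divide_right_mono)
    qed
    then have "h c i \<in> {-\<lceil>M i\<rceil>..\<lfloor>M i\<rfloor>}" for i
      unfolding h_def by (rule floor_in_interval)
    then show "g \<in> R" by (auto simp: g R_def)
  qed
  ultimately have "\<not> inj_on h D"
    using card_inj_on_le[OF _ _ finR] by fastforce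
  then obtain c e where ce: "c \<in> D" "e \<in> D" "c \<noteq> e" "h c = h e"
    unfolding inj_on_def by blast
  define x where "x = v c - v e"
  have x_eq: "x = (\<Sum>b\<in>B. of_int (c b - e b) *\<^sub>R b)"
    by (simp add: x_def v_def sum_subtractf scaleR_diff_left)
  show ?thesis
  proof
    show "x \<in> int_span B"
      unfolding x_eq int_span_def by (auto intro!: exI[of _ "\<lambda>b. c b - e b"])
    show "x \<noteq> 0"
    proof
      assume "x = 0"
      then have "\<forall>b\<in>B. real_of_int (c b - e b) = 0"
        using independentD[OF indep fin subset_refl, of "\<lambda>b. of_int (c b - e b)"]
        unfolding x_eq by blast
      then have "c = e"
        using ce(1,2) unfolding D_def by (intro PiE_ext) auto
      then show False using ce by simp
    qed
    show "\<bar>f i x\<bar> < \<delta> i" for i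
    proof -
      have "\<lfloor>f i (v c) / \<delta> i\<rfloor> = \<lfloor>f i (v e) / \<delta> i\<rfloor>"
        using ce(4) unfolding h_def by meson
      then have "\<bar>f i (v c) / \<delta> i - f i (v e) / \<delta> i\<bar> < 1" by linarith
      then have "\<bar>(f i (v c) - f i (v e)) / \<delta> i\<bar> < 1" by (simp add: diff_divide_distrib)
      then show ?thesis
        using \<delta>_pos[of i] by (simp add: x_def linear_diff[OF lin] abs_divide)
    qed
  qed
qed

section \<open>Discreteness of the lattice and its dual\<close>

text \<open>Linear forms are bounded on bounded sets, so integer-valued ones take finitely many
  values there; if they separate points, finitely many points remain. The dual lattice is treated
  with inner products against \<open>B\<close>, the lattice itself with coordinates relative to
  \<open>B\<close>.\<close>

lemma finite_bounded_int_valued: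
  fixes L :: "(real ^ 'n) set" and g :: "'b \<Rightarrow> real ^ 'n \<Rightarrow> real"
  assumes fin: "finite J" and lin: "\<And>j. j \<in> J \<Longrightarrow> linear (g j)"
    and ints: "\<And>j x. j \<in> J \<Longrightarrow> x \<in> L \<Longrightarrow> g j x \<in> \<int>"
    and inj: "\<And>x y. \<lbrakk>x \<in> L; y \<in> L; \<And>j. j \<in> J \<Longrightarrow> g j x = g j y\<rbrakk> \<Longrightarrow> x = y"
  shows "finite {x \<in> L. infnorm x \<le> r}"
proof -
  define S where "S = {x \<in> L. infnorm x \<le> r}"
  have bdd: "\<exists>a. \<forall>x\<in>S. \<bar>g j x\<bar> \<le> a" if j: "j \<in> J" for j
  proof -
    obtain b where b: "\<And>x. \<bar>g j x\<bar> \<le> b * norm x" "b > 0"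
      using linear_bounded_pos[OF lin[OF j]] by auto
    have "\<bar>g j x\<bar> \<le> b * (sqrt (real CARD('n)) * r)" if "x \<in> S" for x
    proof -
      have "norm x \<le> sqrt (real CARD('n)) * infnorm x" using norm_le_infnorm[of x] by simp
      also have "\<dots> \<le> sqrt (real CARD('n)) * r"
        using that by (intro mult_left_mono) (auto simp: S_def)
      finally show ?thesis using b by (smt (verit, best) mult_left_mono)
    qed
    then show ?thesis by blast
  qed
  then obtain a where a: "\<And>j x. j \<in> J \<Longrightarrow> x \<in> S \<Longrightarrow> \<bar>g j x\<bar> \<le> a j" by metis
  define h where "h x = restrict (\<lambda>j. \<lfloor>g j x\<rfloor>) J" for x
  have "h ` S \<subseteq> PiE J (\<lambda>j. {-\<lceil>a j\<rceil> .. \<lfloor>a j\<rfloor>})"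
  proof -
    have "\<lfloor>g j x\<rfloor> \<in> {-\<lceil>a j\<rceil> .. \<lfloor>a j\<rfloor>}" if "j \<in> J" "x \<in> S" for j x
      using a[OF that] by (rule floor_in_interval)
    then show ?thesis by (auto simp: h_def)
  qed
  then have "finite (h ` S)"
    by (rule finite_subset) (intro finite_PiE fin, auto)
  moreover have "inj_on h S"
  proof (rule inj_onI)
    fix x y assume xy: "x \<in> S" "y \<in> S" "h x = h y"
    have "g j x = g j y" if "j \<in> J" for j
    proof -
      \<comment> \<open>Floors keep the target finite; since \<open>g j\<close> is integer-valued on
        \<open>L\<close>, they lose no information.\<close>
      have "\<lfloor>g j x\<rfloor> = \<lfloor>g j y\<rfloor>" using xy(3) that unfolding h_def by (metis restrict_apply')
      then show ?thesis
        using ints[OF that, of x] ints[OF that, of y] xy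
        by (metis (no_types, lifting) S_def Ints_cases floor_of_int mem_Collect_eq)
    qed
    then show "x = y" using inj xy unfolding S_def by blast
  qed
  ultimately show ?thesis unfolding S_def[symmetric] by (rule finite_imageD)
qed

lemma finite_bounded_dual:
  assumes indep: "independent B" and span: "span B = UNIV"
  shows "finite {y \<in> dual_lattice (int_span B). infnorm y \<le> r}"
proof (rule finite_bounded_int_valued[where J = B and g = "\<lambda>b y. y \<bullet> b"])
  show fin: "finite B" using indep by (rule independent_imp_finite)
  show "linear (\<lambda>y. y \<bullet> b)" for b :: "real ^ 'a"
    by (simp add: bounded_linear.linear bounded_linear_inner_left)
  show "y \<bullet> b \<in> \<int>" if "b \<in> B" "y \<in> dual_lattice (int_span B)" for b y
  proof -
    have "(\<Sum>a\<in>B. of_int (if a = b then 1 else 0) *\<^sub>R a) = (\<Sum>a\<in>B. if a = b then a else 0)"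
      by (intro sum.cong) auto
    also have "\<dots> = b" using that fin by simp
    finally have "b = (\<Sum>a\<in>B. of_int (if a = b then 1 else 0) *\<^sub>R a)" ..
    then have "b \<in> int_span B"
      unfolding int_span_def by (auto intro!: exI[of _ "\<lambda>a. if a = b then 1 else 0"])
    then show ?thesis using that by (simp add: dual_lattice_def)
  qed
  show "x = y" if "\<And>b. b \<in> B \<Longrightarrow> x \<bullet> b = y \<bullet> b" for x y
  proof -
    have "orthogonal (x - y) z" if "z \<in> span B" for z
      using \<open>z \<in> span B\<close> by (rule orthogonal_to_span)
        (simp add: orthogonal_def inner_diff_left \<open>\<And>b. b \<in> B \<Longrightarrow> x \<bullet> b = y \<bullet> b\<close>)
    then have "orthogonal (x - y) (x - y)" using span by simp
    then show ?thesis by (simp add: orthogonal_def)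
  qed
qed

lemma finite_bounded_int_span:
  assumes indep: "independent B" and span: "span B = UNIV"
  shows "finite {x \<in> int_span B. infnorm x \<le> r}"
proof (rule finite_bounded_int_valued[where J = B and g = "\<lambda>b x. representation B x b"])
  show fin: "finite B" using indep by (rule independent_imp_finite)
  show "linear (\<lambda>x. representation B x b)" for b
    by (intro linearI) (auto simp: representation_add representation_scale indep span)
  show "representation B x b \<in> \<int>" if "b \<in> B" "x \<in> int_span B" for b x
  proof -
    obtain c :: "real ^ 'a \<Rightarrow> int" where c: "x = (\<Sum>b\<in>B. of_int (c b) *\<^sub>R b)"
      using \<open>x \<in> int_span B\<close> unfolding int_span_def by blast
    have "representation B x b = (\<Sum>a\<in>B. of_int (c a) * (if a = b then 1 else 0))"
      unfolding c by (auto simp: representation_sum representation_scale representation_basis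
          indep span intro!: sum.cong)
    also have "\<dots> = (\<Sum>a\<in>B. if a = b then of_int (c b) else 0)"
      by (intro sum.cong) auto
    also have "\<dots> = of_int (c b)" using that fin by simp
    finally show ?thesis by simp
  qed
  show "x = y" if "\<And>b. b \<in> B \<Longrightarrow> representation B x b = representation B y b" for x y
  proof -
    have "z = (\<Sum>b\<in>B. representation B z b *\<^sub>R b)" for z
      using sum_representation_eq[OF indep _ fin subset_refl, of z] span by simp
    then have "x = (\<Sum>b\<in>B. representation B x b *\<^sub>R b)"
      "y = (\<Sum>b\<in>B. representation B y b *\<^sub>R b)" by blast+
    then show ?thesis using that by (metis (no_types, lifting) sum.cong)
  qed
qed

section \<open>Product mean, sup-norm and a criterion for infinitely many solutions\<close>

lemma prod_mean_eq: "prod_mean x = (\<Prod>i\<in>UNIV. \<bar>x $ i\<bar>) powr (1 / real CARD('n))"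
  for x :: "real ^ 'n"
  by (simp add: prod_mean_def prod_powr_distrib)

lemma prod_mean_le:
  fixes x :: "real ^ 'n"
  assumes "\<And>i. \<bar>x $ i\<bar> \<le> u i"
  shows "prod_mean x \<le> (\<Prod>i\<in>UNIV. u i) powr (1 / real CARD('n))"
  unfolding prod_mean_eq using assms by (intro powr_mono2 prod_mono) (auto simp: prod_nonneg)

lemma infnorm_le_iff: "infnorm x \<le> a \<longleftrightarrow> (\<forall>i. \<bar>x $ i\<bar> \<le> a)" for x :: "real ^ 'n"
proof
  show "\<forall>i. \<bar>x $ i\<bar> \<le> a" if "infnorm x \<le> a"
    using that component_le_infnorm_cart order_trans by blast
  show "infnorm x \<le> a" if "\<forall>i. \<bar>x $ i\<bar> \<le> a"
    unfolding infnorm_cart by (rule cSup_least) (use that in auto)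
qed

lemma obtains_infnorm_component:
  fixes x :: "real ^ 'n"
  obtains k where "infnorm x = \<bar>x $ k\<bar>"
proof -
  have "{\<bar>x $ i\<bar> |i. i \<in> UNIV} = range (\<lambda>i. \<bar>x $ i\<bar>)" by auto
  then have "infnorm x = Max (range (\<lambda>i. \<bar>x $ i\<bar>))"
    unfolding infnorm_cart by (simp add: cSup_eq_Max)
  then have "infnorm x \<in> range (\<lambda>i. \<bar>x $ i\<bar>)"
    using Max_in[of "range (\<lambda>i. \<bar>x $ i\<bar>)"] by simp
  then show ?thesis using that by auto
qed

text \<open>
  A nonzero lattice point with a vanishing coordinate has all its multiples in \<open>S\<close>; without such
  points, finitely many elements cannot have arbitrarily small coordinates.
\<close>
lemma infinite_if_small_component:
  fixes S :: "(real ^ 'n) set"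
  assumes zero: "\<And>x. x \<in> int_span B \<Longrightarrow> prod_mean x = 0 \<Longrightarrow> x \<in> S"
    and small: "\<And>e. e > 0 \<Longrightarrow> \<exists>x \<in> int_span B \<inter> S. x \<noteq> 0 \<and> (\<exists>i. \<bar>x $ i\<bar> < e)"
  shows "infinite S"
proof
  assume fin: "finite S"
  have nz: "x $ i \<noteq> 0" if x: "x \<in> int_span B" "x \<noteq> 0" for x i
  proof
    assume "x $ i = 0"
    then have "prod_mean (of_nat n *\<^sub>R x) = 0" for n
      unfolding prod_mean_eq by auto
    then have "range (\<lambda>n. of_nat n *\<^sub>R x) \<subseteq> S"
      using zero int_span_of_nat_mult[OF x(1)] by blast
    moreover have "inj (\<lambda>n::nat. of_nat n *\<^sub>R x)" using x by (auto simp: inj_on_def)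
    ultimately show False using fin finite_subset range_inj_infinite by blast
  qed
  define T where "T = (\<lambda>(x, i). \<bar>x $ i\<bar>) ` ((int_span B \<inter> S - {0}) \<times> UNIV)"
  have finT: "finite T" using fin unfolding T_def by auto
  have pos: "\<forall>t\<in>T. t > 0" using nz unfolding T_def by auto
  \<comment> \<open>Inserting 1 keeps the set nonempty when \<open>S\<close> has no nonzero lattice
    point.\<close>
  define e where "e = Min (insert 1 T)"
  have "e > 0" unfolding e_def using finT pos by auto
  then obtain x i where x: "x \<in> int_span B \<inter> S" "x \<noteq> 0" "\<bar>x $ i\<bar> < e" using small by meson
  then have "\<bar>x $ i\<bar> \<in> T" unfolding T_def by force
  then have "e \<le> \<bar>x $ i\<bar>" unfolding e_def using finT by simp
  then show False using x by simp
qed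


section \<open>From a dual point to an orthogonal lattice point\<close>

lemma obtain_component_bound:
  fixes B :: "(real ^ 'n) set"
  assumes fin: "finite B"
  obtains A where "A > 0" "\<And>b i. b \<in> B \<Longrightarrow> \<bar>b $ i\<bar> \<le> A"
proof
  show "1 + (\<Sum>b\<in>B. infnorm b) > 0"
    by (simp add: add_pos_nonneg infnorm_pos_le sum_nonneg)
  show "\<bar>b $ i\<bar> \<le> 1 + (\<Sum>b\<in>B. infnorm b)" if "b \<in> B" for b i
  proof -
    have "\<bar>b $ i\<bar> \<le> infnorm b" by (rule component_le_infnorm_cart)
    also have "\<dots> \<le> (\<Sum>b\<in>B. infnorm b)"
      using fin that by (intro member_le_sum) (auto simp: infnorm_pos_le)
    finally show ?thesis by simp
  qed
qed

text \<open>
  Pigeonhole is applied to the forms \<open>x\<^sub>i\<close> (\<open>i \<noteq> k\<close>) and \<open>\<langle>y, x\<rangle>\<close>. The latter is an integer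
  of absolute value below 1, hence 0, and this relation bounds the remaining coordinate \<open>x\<^sub>k\<close>.
\<close>
lemma transference:
  assumes indep: "independent (B :: (real ^ 'n) set)" and span: "span B = UNIV"
    and card: "CARD('n) \<ge> 2"
  obtains C where "C > 0"
    and "\<And>y l k. \<lbrakk>y \<in> dual_lattice (int_span B); \<And>i. \<bar>y $ i\<bar> \<le> l i; \<And>i. 0 < l i; \<And>i. l i \<le> l k;
           \<bar>y $ k\<bar> = l k\<rbrakk> \<Longrightarrow>
         \<exists>x\<in>int_span B. x \<noteq> 0 \<and>
           (\<forall>i. \<bar>x $ i\<bar> \<le> C * (\<Prod>i\<in>UNIV. l i) powr (1 / (real CARD('n) - 1)) / l i)"
proof -
  define d where "d = real CARD('n)"
  define m where "m = CARD('n) - 1"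
  have m: "m \<ge> 1" "real m = d - 1" "CARD('n) = Suc m" using card by (auto simp: d_def m_def)
  have d2: "d \<ge> 2" using card by (simp add: d_def)
  have fin: "finite B" using indep by (rule independent_imp_finite)
  obtain A where A_pos: "A > 0" and A: "\<And>b i. b \<in> B \<Longrightarrow> \<bar>b $ i\<bar> \<le> A"
    using obtain_component_bound[OF fin] by blast
  \<comment> \<open>The product of the numbers \<open>3 * d * K i\<close> will be
    \<open>G * l k\<close>. With \<open>c = 1 + G\<close> and \<open>m \<ge> 1\<close> one gets
    \<open>c ^ m \<ge> c > G\<close>.\<close>
  define G where "G = 3 * d * (d * A) * (3 * d * A) ^ m"
  have G_pos: "G > 0" using d2 A_pos by (simp add: G_def)
  define c where "c = 1 + G"
  have c: "c ^ m > G"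
    using power_increasing[of 1 m c] m(1) G_pos by (simp add: c_def)
  have c_pos: "c > 0" using G_pos by (simp add: c_def)
  show ?thesis
  proof (rule that[of "d * c"])
    show "d * c > 0" using d2 c_pos by simp
    fix y :: "real ^ 'n" and l :: "'n \<Rightarrow> real" and k
    assume y: "y \<in> dual_lattice (int_span B)" and yl: "\<And>i. \<bar>y $ i\<bar> \<le> l i"
      and l_pos: "\<And>i. 0 < l i" and lk: "\<And>i. l i \<le> l k" and yk: "\<bar>y $ k\<bar> = l k"
    define P where "P = (\<Prod>i\<in>UNIV. l i)"
    have P_pos: "P > 0" unfolding P_def using l_pos by (simp add: prod_pos)
    \<comment> \<open>\<open>r\<close> is the \<open>m\<close>-th root of \<open>P\<close>, so that
      the product of the \<open>\<delta> i\<close> collapses to \<open>c ^ m * l k\<close>, which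
      exceeds \<open>G * l k\<close>.\<close>
    define r where "r = P powr (1 / (d - 1))"
    have r_pos: "r > 0" using P_pos by (simp add: r_def)
    have r: "r ^ m = P"
      using r_pos P_pos m d2 by (simp add: r_def powr_realpow[symmetric] powr_powr)
    have P_k: "P = l k * (\<Prod>i\<in>UNIV - {k}. l i)"
      unfolding P_def by (rule prod.remove) auto
    have card_k: "card (UNIV - {k}) = m" by (simp add: m_def)
    define f where "f i x = (if i = k then y \<bullet> x else x $ i)" for i and x :: "real ^ 'n"
    define K where "K i = (if i = k then d * A * l k else A)" for i
    define \<delta> where "\<delta> i = (if i = k then 1 else c * r / l i)" for i
    have "(\<Prod>i\<in>UNIV. 3 * real CARD('n) * K i)
        = 3 * d * K k * (\<Prod>i\<in>UNIV - {k}. 3 * real CARD('n) * K i)"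
      unfolding d_def by (rule prod.remove) auto
    also have "(\<Prod>i\<in>UNIV - {k}. 3 * real CARD('n) * K i) = (\<Prod>i\<in>UNIV - {k}. 3 * d * A)"
      by (intro prod.cong) (auto simp: K_def d_def)
    also have "\<dots> = (3 * d * A) ^ m" using card_k by simp
    also have "3 * d * K k * (3 * d * A) ^ m = G * l k" by (simp add: K_def G_def)
    finally have prodK: "(\<Prod>i\<in>UNIV. 3 * real CARD('n) * K i) = G * l k" .
    have "(\<Prod>i\<in>UNIV. \<delta> i) = \<delta> k * (\<Prod>i\<in>UNIV - {k}. \<delta> i)"
      by (rule prod.remove) auto
    also have "(\<Prod>i\<in>UNIV - {k}. \<delta> i) = (\<Prod>i\<in>UNIV - {k}. c * r / l i)"
      by (intro prod.cong) (auto simp: \<delta>_def)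
    also have "\<dots> = (c * r) ^ m / (\<Prod>i\<in>UNIV - {k}. l i)"
      using card_k by (simp add: prod_dividef)
    also have "\<dots> = c ^ m * P / (P / l k)"
      using P_k l_pos[of k] by (simp add: power_mult_distrib r)
    finally have prod\<delta>: "(\<Prod>i\<in>UNIV. \<delta> i) = c ^ m * l k"
      using P_pos by (simp add: \<delta>_def)
    obtain x where x: "x \<in> int_span B" "x \<noteq> 0" and fx: "\<And>i. \<bar>f i x\<bar> < \<delta> i"
    proof (rule linear_forms_small[OF indep span, of f K \<delta>])
      show "linear (f i)" for i
        unfolding f_def by (cases "i = k")
          (auto simp: bounded_linear.linear bounded_linear_inner_right bounded_linear_vec_nth)
      show "0 < K i" for i using d2 A_pos l_pos by (simp add: K_def)
      show "0 < \<delta> i" for i using c_pos r_pos l_pos by (simp add: \<delta>_def)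
      show "(\<Prod>i\<in>UNIV. 3 * real CARD('n) * K i) < (\<Prod>i\<in>UNIV. \<delta> i)"
        unfolding prodK prod\<delta> using c l_pos by simp
      show "\<bar>f i b\<bar> \<le> K i" if b: "b \<in> B" for i b
      proof (cases "i = k")
        case True
        have "\<bar>y \<bullet> b\<bar> \<le> (\<Sum>i\<in>UNIV. \<bar>y $ i * b $ i\<bar>)"
          unfolding inner_vec_def inner_real_def by (rule sum_abs)
        also have "\<dots> \<le> (\<Sum>i\<in>(UNIV :: 'n set). l k * A)"
          unfolding abs_mult using A[OF b] yl lk l_pos[of k] order_trans[OF yl lk]
          by (intro sum_mono mult_mono) auto
        finally show ?thesis using True by (simp add: f_def K_def d_def mult_ac)
      qed (use A b in \<open>auto simp: f_def K_def\<close>)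
    qed blast
    have x_less: "\<bar>x $ i\<bar> < c * r / l i" if "i \<noteq> k" for i
      using fx[of i] that by (simp add: f_def \<delta>_def)
    have "y \<bullet> x \<in> \<int>" using y x by (simp add: dual_lattice_def)
    moreover have "\<bar>y \<bullet> x\<bar> < 1" using fx[of k] by (simp add: f_def \<delta>_def)
    ultimately have "y \<bullet> x = 0" by (metis Ints_nonzero_abs_less1)
    moreover have "y \<bullet> x = y $ k * x $ k + (\<Sum>i\<in>UNIV - {k}. y $ i * x $ i)"
      unfolding inner_vec_def inner_real_def by (rule sum.remove) auto
    ultimately have "\<bar>y $ k * x $ k\<bar> = \<bar>\<Sum>i\<in>UNIV - {k}. y $ i * x $ i\<bar>" by linarith
    also have "\<dots> \<le> (\<Sum>i\<in>UNIV - {k}. \<bar>y $ i * x $ i\<bar>)" by (rule sum_abs)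
    also have "\<dots> \<le> (\<Sum>i\<in>UNIV - {k}. c * r)"
    proof (rule sum_mono)
      fix i assume "i \<in> UNIV - {k}"
      then have "\<bar>y $ i\<bar> * \<bar>x $ i\<bar> \<le> l i * (c * r / l i)"
        using yl[of i] x_less[of i] l_pos[of i] by (intro mult_mono) auto
      then show "\<bar>y $ i * x $ i\<bar> \<le> c * r" using l_pos[of i] by (simp add: abs_mult)
    qed
    also have "\<dots> = real m * (c * r)" using card_k by simp
    \<comment> \<open>Weakening \<open>m\<close> to \<open>d\<close> gives the constant
      \<open>d * c\<close>, which serves for \<open>x $ k\<close> and for all other
      coordinates.\<close>
    also have "\<dots> \<le> d * (c * r)" using m c_pos r_pos by (intro mult_right_mono) auto
    finally have "\<bar>x $ k\<bar> \<le> d * c * r / l k"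
      using l_pos[of k] yk by (simp add: abs_mult field_simps)
    moreover have "\<bar>x $ i\<bar> \<le> d * c * r / l i" if "i \<noteq> k" for i
    proof -
      have "\<bar>x $ i\<bar> \<le> 1 * (c * r / l i)" using x_less[OF that] by simp
      also have "\<dots> \<le> d * (c * r / l i)"
        using d2 c_pos r_pos l_pos[of i] by (intro mult_right_mono) auto
      finally show ?thesis by simp
    qed
    ultimately have "\<bar>x $ i\<bar> \<le> d * c * r / l i" for i by (cases "i = k") auto
    then show "\<exists>x\<in>int_span B. x \<noteq> 0 \<and>
           (\<forall>i. \<bar>x $ i\<bar> \<le> d * c * (\<Prod>i\<in>UNIV. l i) powr (1 / (real CARD('n) - 1)) / l i)"
      using x by (auto simp: r_def P_def d_def)
  qed
qed

text \<open>Raising every coordinate to at least a common level \<open>t\<close> changes the product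
  continuously, from at most \<open>P\<close> at \<open>t = 0\<close> to at least \<open>P\<close>
  at \<open>t = infnorm y\<close>; the intermediate value theorem picks \<open>t\<close>. Vanishing
  coordinates become positive, so that \<open>l i\<close> can be divided by.\<close>

lemma enlarge_to_prod:
  fixes y :: "real ^ 'n"
  assumes "(\<Prod>i\<in>UNIV. \<bar>y $ i\<bar>) \<le> P" "P \<le> infnorm y ^ CARD('n)" "P > 0"
  obtains l where "\<And>i. \<bar>y $ i\<bar> \<le> l i" "\<And>i. 0 < l i" "\<And>i. l i \<le> infnorm y" "(\<Prod>i\<in>UNIV. l i) = P"
proof -
  have "\<exists>t. 0 \<le> t \<and> t \<le> infnorm y \<and> (\<Prod>i\<in>UNIV. max \<bar>y $ i\<bar> t) = P"
  proof (rule IVT')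
    show "(\<Prod>i\<in>UNIV. max \<bar>y $ i\<bar> 0) \<le> P" using assms(1) by (simp add: max_absorb1)
    have "max \<bar>y $ i\<bar> (infnorm y) = infnorm y" for i
      using component_le_infnorm_cart[of y i] by simp
    then show "P \<le> (\<Prod>i\<in>UNIV. max \<bar>y $ i\<bar> (infnorm y))" using assms(2) by simp
  qed (auto simp: infnorm_pos_le intro!: continuous_intros)
  then obtain t where t: "0 \<le> t" "t \<le> infnorm y" "(\<Prod>i\<in>UNIV. max \<bar>y $ i\<bar> t) = P" by blast
  show ?thesis
  proof (rule that[of "\<lambda>i. max \<bar>y $ i\<bar> t"])
    show "0 < max \<bar>y $ i\<bar> t" for i
    proof -
      have "max \<bar>y $ i\<bar> t \<noteq> 0" using t(3) assms(3) by (metis UNIV_I finite less_irrefl prod_zero)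
      then show ?thesis using t(1) by linarith
    qed
  qed (use t component_le_infnorm_cart[of y] in auto)
qed

section \<open>Transfer of exponents from the dual lattice\<close>

text \<open>The strict bound on \<open>\<beta>\<close> leaves a spare power of
  \<open>infnorm y\<close> that absorbs the constant from \<open>transference\<close>. Different
  \<open>y\<close> need not give different \<open>x\<close>, so infinitude is obtained from
  arbitrarily small coordinates.\<close>

lemma exponent_transfer:
  fixes B :: "(real ^ 'n) set" and \<gamma> \<beta> :: real
  defines "d \<equiv> real CARD('n)"
  assumes indep: "independent B" and span: "span B = UNIV" and card: "CARD('n) \<ge> 2"
    and \<gamma>: "\<gamma> > 0" and \<beta>: "0 < \<beta>" "\<beta> < \<gamma> / ((d - 1)\<^sup>2 + d * (d - 2) * \<gamma>)"
    and inf: "infinite {y \<in> dual_lattice (int_span B). prod_mean y \<le> infnorm y powr (- \<gamma>)}"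
  shows "infinite {x \<in> int_span B. prod_mean x \<le> infnorm x powr (- \<beta>)}"
proof (rule infinite_if_small_component)
  show "x \<in> {x \<in> int_span B. prod_mean x \<le> infnorm x powr (- \<beta>)}"
    if "x \<in> int_span B" "prod_mean x = 0" for x using that by simp
  fix e :: real assume e: "e > 0"
  have d2: "d \<ge> 2" using card by (simp add: d_def)
  obtain C where C: "C > 0" and trans:
    "\<And>y l k. \<lbrakk>y \<in> dual_lattice (int_span B); \<And>i. \<bar>y $ i\<bar> \<le> l i; \<And>i. 0 < l i; \<And>i. l i \<le> l k;
           \<bar>y $ k\<bar> = l k\<rbrakk> \<Longrightarrow>
         \<exists>x\<in>int_span B. x \<noteq> 0 \<and>
           (\<forall>i. \<bar>x $ i\<bar> \<le> C * (\<Prod>i\<in>UNIV. l i) powr (1 / (d - 1)) / l i)"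
    using transference[OF indep span card] unfolding d_def by metis
  define E where "E = d - 1 + \<gamma> * d * (d - 2) / (d - 1)"
  have "\<beta> * ((d - 1)\<^sup>2 + d * (d - 2) * \<gamma>) < \<gamma>"
    using \<beta>(2) d2 \<gamma> by (simp add: pos_less_divide_eq add_pos_nonneg)
  moreover have "(d - 1)\<^sup>2 + d * (d - 2) * \<gamma> = E * (d - 1)"
    using d2 by (simp add: E_def field_simps power2_eq_square)
  ultimately have "\<beta> * E < \<gamma> / (d - 1)" using d2 by (simp add: pos_less_divide_eq mult_ac)
  \<comment> \<open>The slack is positive because \<open>E * (d - 1)\<close> is the denominator in
    the bound on \<open>\<beta>\<close>.\<close>
  define s where "s = \<gamma> / (d - 1) - \<beta> * E"
  have s: "s > 0" using \<open>\<beta> * E < \<gamma> / (d - 1)\<close> by (simp add: s_def)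
  \<comment> \<open>The three entries serve \<open>Y > 1\<close>, \<open>C / Y < e\<close> and
    \<open>C powr (1 + \<beta>) \<le> Y powr s\<close>, in this order.\<close>
  define Y0 where "Y0 = max 1 (max (2 * C / e) ((C powr (1 + \<beta>)) powr (1 / s)))"
  have "\<not> {y \<in> dual_lattice (int_span B). prod_mean y \<le> infnorm y powr (- \<gamma>)}
      \<subseteq> {y \<in> dual_lattice (int_span B). infnorm y \<le> Y0}"
    using inf finite_bounded_dual[OF indep span] finite_subset by blast
  then obtain y where y: "y \<in> dual_lattice (int_span B)" "prod_mean y \<le> infnorm y powr (- \<gamma>)"
    "infnorm y > Y0" by force
  define Y where "Y = infnorm y"
  have Y1: "Y > 1" and YC: "C / Y < e" and Ys: "C powr (1 + \<beta>) \<le> Y powr s"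
  proof -
    show "Y > 1" using y(3) by (simp add: Y_def Y0_def)
    have "2 * C / e < Y" using y(3) by (simp add: Y_def Y0_def)
    then show "C / Y < e" using \<open>Y > 1\<close> e C by (simp add: field_simps)
    have "((C powr (1 + \<beta>)) powr (1 / s)) powr s \<le> Y powr s"
      using y(3) s by (intro powr_mono2) (auto simp: Y_def Y0_def)
    then show "C powr (1 + \<beta>) \<le> Y powr s" using s C by (simp add: powr_powr)
  qed
  define P where "P = Y powr (- \<gamma> * d)"
  have P_pos: "P > 0" using Y1 by (simp add: P_def)
  have "(\<Prod>i\<in>UNIV. \<bar>y $ i\<bar>) = prod_mean y powr d"
    unfolding prod_mean_eq d_def by (simp add: powr_powr prod_nonneg)
  also have "\<dots> \<le> (Y powr (- \<gamma>)) powr d"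
    using y(2) d2 by (intro powr_mono2) (auto simp: Y_def prod_mean_eq)
  also have "\<dots> = P" by (simp add: P_def powr_powr)
  finally have P_ge: "(\<Prod>i\<in>UNIV. \<bar>y $ i\<bar>) \<le> P" .
  have "P \<le> Y powr d"
    unfolding P_def using Y1 \<gamma> d2 by (intro powr_mono) (auto simp: mult_nonneg_nonneg order_trans[of _ 0])
  then have P_le: "P \<le> infnorm y ^ CARD('n)"
    using Y1 by (simp add: d_def powr_realpow Y_def)
  obtain l where l: "\<And>i. \<bar>y $ i\<bar> \<le> l i" "\<And>i. 0 < l i" "\<And>i. l i \<le> Y" "(\<Prod>i\<in>UNIV. l i) = P"
    using enlarge_to_prod[OF P_ge P_le P_pos] unfolding Y_def by blast
  obtain k where k: "Y = \<bar>y $ k\<bar>" unfolding Y_def by (rule obtains_infnorm_component)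
  have lk: "l k = Y" using l(1)[of k] l(3)[of k] k by simp
  define r where "r = P powr (1 / (d - 1))"
  have r_eq: "r = Y powr (- \<gamma> * d / (d - 1))" by (simp add: r_def P_def powr_powr)
  have r_pos: "r > 0" using Y1 by (simp add: r_eq)
  obtain x where x: "x \<in> int_span B" "x \<noteq> 0" "\<And>i. \<bar>x $ i\<bar> \<le> C * r / l i"
  proof -
    have "l i \<le> l k" for i using l(3) lk by simp
    then show ?thesis
      using trans[of y l k, OF y(1) l(1,2)] lk k that unfolding l(4) r_def by metis
  qed
  have "prod_mean x \<le> (\<Prod>i\<in>UNIV. C * r / l i) powr (1 / d)"
    unfolding d_def by (rule prod_mean_le) (rule x)
  \<comment> \<open>The \<open>l i\<close> enter only through their product \<open>P\<close>, so
    their individual sizes do not affect the mean.\<close>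
  also have "(\<Prod>i\<in>UNIV. C * r / l i) = (C * r) powr d / P"
    using C r_pos by (simp add: prod_dividef l(4) d_def powr_realpow)
  also have "((C * r) powr d / P) powr (1 / d) = C * r / P powr (1 / d)"
    using C r_pos d2 P_pos by (simp add: powr_divide powr_powr)
  also have "\<dots> = C * Y powr (- \<gamma> * d / (d - 1) - (- \<gamma>))"
  proof -
    have "P powr (1 / d) = Y powr (- \<gamma>)" using d2 by (simp add: P_def powr_powr)
    then show ?thesis by (simp only: r_eq powr_diff) simp
  qed
  also have "- \<gamma> * d / (d - 1) - (- \<gamma>) = - (\<gamma> / (d - 1))"
    using d2 by (simp add: field_simps)
  finally have prod_x: "prod_mean x \<le> C * Y powr (- (\<gamma> / (d - 1)))" .
  have "\<bar>x $ i\<bar> \<le> C * Y powr E" for i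
  proof -
    \<comment> \<open>Bounding the other \<open>d - 1\<close> factors of \<open>P\<close> by
      \<open>Y\<close> bounds \<open>l i\<close> from below, hence \<open>x $ i\<close> from
      above.\<close>
    have "P = l i * (\<Prod>j\<in>UNIV - {i}. l j)"
      unfolding l(4)[symmetric] by (rule prod.remove) auto
    also have "\<dots> \<le> l i * (\<Prod>j\<in>UNIV - {i}. Y)"
      using l less_imp_le[OF l(2)] by (intro mult_left_mono prod_mono) auto
    also have "\<dots> = l i * Y powr (d - 1)"
      using Y1 card by (simp add: d_def powr_realpow[symmetric] of_nat_diff)
    finally have "P \<le> l i * Y powr (d - 1)" .
    then have "1 / l i \<le> Y powr (d - 1) / P"
      using P_pos l(2)[of i] by (simp add: field_simps)
    then have "C * r * (1 / l i) \<le> C * r * (Y powr (d - 1) / P)"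
      using C r_pos by (intro mult_left_mono) auto
    also have "\<dots> = C * Y powr (- \<gamma> * d / (d - 1) + (d - 1) - (- \<gamma> * d))"
      by (simp only: r_eq P_def powr_add powr_diff) simp
    also have "- \<gamma> * d / (d - 1) + (d - 1) - (- \<gamma> * d) = E"
      using d2 by (simp add: E_def field_simps)
    finally show ?thesis using x(3)[of i] by simp
  qed
  then have inf_x: "infnorm x \<le> C * Y powr E" by (simp add: infnorm_le_iff)
  have inf_x_pos: "infnorm x > 0" using x(2) by (simp add: infnorm_pos_lt)
  \<comment> \<open>Multiplied by \<open>C powr (- \<beta>)\<close>, this compares the bound
    \<open>prod_x\<close> with \<open>(C * Y powr E) powr (- \<beta>)\<close>; the negative exponent
    then reverses \<open>inf_x\<close>.\<close>
  have "C powr (1 + \<beta>) * Y powr (- (\<gamma> / (d - 1))) \<le> Y powr s * Y powr (- (\<gamma> / (d - 1)))"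
    using Ys by (intro mult_right_mono) auto
  also have "\<dots> = Y powr (E * (- \<beta>))" by (simp add: powr_add[symmetric] s_def mult.commute)
  finally have "C powr (- \<beta>) * (C powr (1 + \<beta>) * Y powr (- (\<gamma> / (d - 1))))
      \<le> C powr (- \<beta>) * Y powr (E * (- \<beta>))" by (intro mult_left_mono) auto
  also have "C powr (- \<beta>) * (C powr (1 + \<beta>) * Y powr (- (\<gamma> / (d - 1))))
      = C * Y powr (- (\<gamma> / (d - 1)))"
    using C by (simp add: mult.assoc[symmetric] powr_add[symmetric])
  also have "C powr (- \<beta>) * Y powr (E * (- \<beta>)) = (C * Y powr E) powr (- \<beta>)"
    using C Y1 by (simp add: powr_mult powr_powr)
  also have "\<dots> \<le> infnorm x powr (- \<beta>)"
    using inf_x inf_x_pos \<beta>(1) by (intro powr_mono2') auto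
  finally have "prod_mean x \<le> infnorm x powr (- \<beta>)" using prod_x by linarith
  \<comment> \<open>Coordinate \<open>k\<close> is the small one: its divisor is
    \<open>l k = Y\<close>, and \<open>r \<le> 1\<close>.\<close>
  moreover have "\<bar>x $ k\<bar> < e"
  proof -
    have "r \<le> Y powr 0"
      unfolding r_eq using Y1 \<gamma> d2 by (intro powr_mono) auto
    then have "C * r / Y \<le> C * 1 / Y" using C Y1 by (intro divide_right_mono mult_left_mono) auto
    then show ?thesis using x(3)[of k] lk YC by simp
  qed
  ultimately show "\<exists>x\<in>int_span B \<inter> {x \<in> int_span B. prod_mean x \<le> infnorm x powr (- \<beta>)}.
      x \<noteq> 0 \<and> (\<exists>i. \<bar>x $ i\<bar> < e)"
    using x by blast
qed

section \<open>Nonnegativity and range of the exponent\<close>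

text \<open>One side of a box is made arbitrarily short and another correspondingly long, at
  constant volume; pigeonhole then gives points of bounded mean with an arbitrarily small
  coordinate.\<close>

lemma infinite_bounded_prod_mean:
  assumes indep: "independent (B :: (real ^ 'n) set)" and span: "span B = UNIV"
    and card: "CARD('n) \<ge> 2"
  obtains C where "infinite {x \<in> int_span B. prod_mean x \<le> C}"
proof -
  define d where "d = real CARD('n)"
  have d2: "d \<ge> 2" using card by (simp add: d_def)
  have fin: "finite B" using indep by (rule independent_imp_finite)
  obtain A where A_pos: "A > 0" and A: "\<And>b i. b \<in> B \<Longrightarrow> \<bar>b $ i\<bar> \<le> A"
    using obtain_component_bound[OF fin] by blast
  define C where "C = 3 * d * A + 1"
  have C_pos: "C > 0" using A_pos d2 by (simp add: C_def add_pos_pos)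
  obtain j k :: 'n where jk: "j \<noteq> k"
    using card card_le_Suc0_iff_eq[of "UNIV :: 'n set"] by fastforce
  have "infinite {x \<in> int_span B. prod_mean x \<le> C}"
  proof (rule infinite_if_small_component)
    show "x \<in> {x \<in> int_span B. prod_mean x \<le> C}" if "x \<in> int_span B" "prod_mean x = 0" for x
      using that C_pos by simp
    fix e :: real assume e: "e > 0"
    \<comment> \<open>The weights multiply to 1, and side \<open>j\<close> of the box becomes
      exactly \<open>e\<close>.\<close>
    define w where "w i = (if i = j then e / C else if i = k then C / e else 1)" for i
    have w_pos: "w i > 0" for i using C_pos e by (simp add: w_def)
    have "(\<Prod>i\<in>UNIV. w i) = w j * (w k * (\<Prod>i\<in>UNIV - {j} - {k}. w i))"
      using jk by (subst prod.remove[of _ j], simp, simp, subst prod.remove[of _ k]) auto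
    also have "(\<Prod>i\<in>UNIV - {j} - {k}. w i) = 1" by (intro prod.neutral) (auto simp: w_def)
    finally have prod_w: "(\<Prod>i\<in>UNIV. w i) = 1" using jk C_pos e by (simp add: w_def)
    then have prod_Cw: "(\<Prod>i\<in>UNIV. C * w i) = C ^ CARD('n)" by (simp add: prod.distrib)
    obtain x where x: "x \<in> int_span B" "x \<noteq> 0" "\<And>i. \<bar>x $ i\<bar> < C * w i"
    proof (rule linear_forms_small[OF indep span, of "\<lambda>i x. x $ i" "\<lambda>_. A" "\<lambda>i. C * w i"])
      show "linear (\<lambda>x :: real ^ 'n. x $ i)" for i
        by (simp add: bounded_linear.linear bounded_linear_vec_nth)
      show "(\<Prod>i\<in>(UNIV :: 'n set). 3 * real CARD('n) * A) < (\<Prod>i\<in>UNIV. C * w i)"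
        unfolding prod_Cw using A_pos by (simp add: C_def d_def power_strict_mono)
    qed (use A A_pos C_pos w_pos in auto)
    have "prod_mean x \<le> (\<Prod>i\<in>UNIV. C * w i) powr (1 / d)"
      unfolding d_def by (rule prod_mean_le) (use x(3) less_imp_le in blast)
    also have "\<dots> = C"
      unfolding prod_Cw using C_pos d2 by (simp add: powr_realpow[symmetric] powr_powr d_def)
    finally have "prod_mean x \<le> C" .
    moreover have "\<bar>x $ j\<bar> < e" using x(3)[of j] C_pos by (simp add: w_def)
    ultimately show "\<exists>x\<in>int_span B \<inter> {x \<in> int_span B. prod_mean x \<le> C}.
        x \<noteq> 0 \<and> (\<exists>i. \<bar>x $ i\<bar> < e)"
      using x by blast
  qed
  then show ?thesis by (rule that)
qed

lemma dioph_exponent_ge: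
  assumes "infinite {x \<in> L. prod_mean x \<le> infnorm x powr (- \<gamma>)}"
  shows "ereal \<gamma> \<le> dioph_exponent L"
  unfolding dioph_exponent_def using assms by (intro Sup_upper) blast

text \<open>For each \<open>e > 0\<close> a constant bound on the mean lies below
  \<open>infnorm x powr e\<close> off a bounded set, which holds only finitely many lattice points.
  So every negative number is at most the exponent.\<close>

lemma dioph_exponent_nonneg:
  assumes indep: "independent (B :: (real ^ 'n) set)" and span: "span B = UNIV"
    and card: "CARD('n) \<ge> 2"
  shows "dioph_exponent (int_span B) \<ge> 0"
proof -
  obtain C where C: "infinite {x \<in> int_span B. prod_mean x \<le> C}"
    by (rule infinite_bounded_prod_mean[OF assms])
  have "ereal (- e) \<le> dioph_exponent (int_span B)" if e: "e > 0" for e :: real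
  proof (rule dioph_exponent_ge)
    \<comment> \<open>Chosen so that \<open>R powr e = max 1 C\<close>; the maximum keeps the base
      positive even if \<open>C\<close> is not.\<close>
    define R where "R = max 1 C powr (1 / e)"
    have "x \<in> {x \<in> int_span B. prod_mean x \<le> infnorm x powr (- (- e))} \<union>
        {x \<in> int_span B. infnorm x \<le> R}" if x: "x \<in> int_span B" "prod_mean x \<le> C" for x
    proof (cases "infnorm x \<le> R")
      case False
      then have "R powr e \<le> infnorm x powr e" using e by (intro powr_mono2) (auto simp: R_def)
      then have "max 1 C \<le> infnorm x powr e" using e by (simp add: R_def powr_powr)
      then show ?thesis using x by simp
    qed (use x in simp)
    then have "{x \<in> int_span B. prod_mean x \<le> C} \<subseteq>
        {x \<in> int_span B. prod_mean x \<le> infnorm x powr (- (- e))} \<union>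
        {x \<in> int_span B. infnorm x \<le> R}" by blast
    then show "infinite {x \<in> int_span B. prod_mean x \<le> infnorm x powr (- (- e))}"
      using C finite_bounded_int_span[OF indep span, of R] by (meson finite_UnI finite_subset)
  qed
  then have *: "ereal q \<le> dioph_exponent (int_span B)" if "q < 0" for q
    using that by (metis minus_minus neg_0_less_iff_less)
  show ?thesis
  proof (rule ccontr)
    assume "\<not> ?thesis"
    then obtain q where "dioph_exponent (int_span B) < ereal q" "ereal q < 0"
      using ereal_dense2 by (metis not_le)
    then show False using *[of q] by simp
  qed
qed

lemma prod_mean_le_infnorm: "prod_mean x \<le> infnorm x" for x :: "real ^ 'n"
proof -
  have "prod_mean x \<le> (\<Prod>i\<in>(UNIV :: 'n set). infnorm x) powr (1 / real CARD('n))"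
    by (rule prod_mean_le) (rule component_le_infnorm_cart)
  also have "\<dots> = infnorm x"
    using infnorm_pos_le[of x]
    by (cases "infnorm x = 0") (auto simp: powr_realpow[symmetric] powr_powr)
  finally show ?thesis .
qed

text \<open>For infinite \<open>L\<close> the value -1 is always admissible, because the mean is at
  most the sup-norm; for finite \<open>L\<close> the supremum is over the empty set. The bound -1
  keeps the denominator in the theorem positive.\<close>

lemma dioph_exponent_cases:
  "dioph_exponent L = -\<infinity> \<or> dioph_exponent L \<ge> -1" for L :: "(real ^ 'n) set"
proof (cases "finite L")
  case True
  then have "\<nexists>\<gamma>. infinite {x \<in> L. prod_mean x \<le> infnorm x powr (- \<gamma>)}" by simp
  then show ?thesis unfolding dioph_exponent_def by (simp add: bot_ereal_def)
next
  case False
  have "{x \<in> L. prod_mean x \<le> infnorm x powr (- (-1))} = L"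
    using prod_mean_le_infnorm by (auto simp: infnorm_pos_le)
  then show ?thesis using dioph_exponent_ge[of L "-1"] False by (auto simp: one_ereal_def)
qed

section \<open>Passage to the supremum\<close>

theorem theorem2:
  fixes L :: "(real ^ 'n) set"
  assumes "CARD('n) \<ge> 3"
    and "full_rank_lattice L"
  shows "dioph_exponent L \<ge>
    (if dioph_exponent (dual_lattice L) = \<infinity>
     then ereal (1 / (real CARD('n) * (real CARD('n) - 2)))
     else dioph_exponent (dual_lattice L) /
       (ereal ((real CARD('n) - 1)\<^sup>2)
         + ereal (real CARD('n) * (real CARD('n) - 2)) * dioph_exponent (dual_lattice L)))"
proof -
  obtain B where B: "independent B" "span B = UNIV" and L: "L = int_span B"
    using assms(2) unfolding full_rank_lattice_def int_span_def by blast
  have card: "CARD('n) \<ge> 2" using assms(1) by simp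
  define d where "d = real CARD('n)"
  have d3: "d \<ge> 3" using assms(1) by (simp add: d_def)
  define \<omega> where "\<omega> = dioph_exponent (dual_lattice L)"
  define a where "a = (d - 1)\<^sup>2"
  define b where "b = d * (d - 2)"
  have ab: "a > 0" "b > 0" "a = b + 1"
    using d3 by (simp add: a_def, simp add: b_def, simp add: a_def b_def power2_eq_square algebra_simps)
  define \<phi> where "\<phi> g = g / (a + b * g)" for g
  have nonneg: "dioph_exponent L \<ge> 0" unfolding L by (rule dioph_exponent_nonneg[OF B card])
  \<comment> \<open>The supremum need not be attained, so \<open>g\<close> stays strictly below
    \<open>\<omega>\<close>. Some admissible \<open>\<gamma>\<close> exceeds \<open>g\<close>, and
    \<open>\<phi>\<close> is increasing on positive arguments.\<close>
  have phi_le: "ereal (\<phi> g) \<le> dioph_exponent L" if g: "0 < g" "ereal g < \<omega>" for g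
  proof -
    obtain \<gamma> where \<gamma>: "g < \<gamma>"
      "infinite {y \<in> dual_lattice L. prod_mean y \<le> infnorm y powr (- \<gamma>)}"
      using g(2) unfolding \<omega>_def dioph_exponent_def less_Sup_iff by auto
    have "\<phi> g \<le> \<phi> \<gamma>"
      unfolding \<phi>_def
    proof (rule iffD2[OF frac_le_eq])
      show "a + b * g \<noteq> 0" "a + b * \<gamma> \<noteq> 0"
        using \<gamma>(1) g(1) ab mult_pos_pos[of b g] mult_pos_pos[of b \<gamma>] by linarith+
      have "(g * (a + b * \<gamma>) - \<gamma> * (a + b * g)) = a * (g - \<gamma>)" by (simp add: algebra_simps)
      also have "\<dots> \<le> 0" using \<gamma>(1) ab by (simp add: mult_nonneg_nonpos)
      finally show "(g * (a + b * \<gamma>) - \<gamma> * (a + b * g)) / ((a + b * g) * (a + b * \<gamma>)) \<le> 0"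
        using \<gamma>(1) g(1) ab by (intro divide_nonpos_pos) (auto intro!: mult_pos_pos add_pos_pos)
    qed
    have "ereal \<beta> \<le> dioph_exponent L" if "0 < \<beta>" "\<beta> < \<phi> \<gamma>" for \<beta>
      unfolding L using that \<gamma> g(1)
      by (intro dioph_exponent_ge exponent_transfer[OF B card, of \<gamma>])
        (auto simp: \<phi>_def a_def b_def d_def L)
    moreover have "\<phi> g > 0" using g ab by (simp add: \<phi>_def add_pos_pos)
    ultimately have *: "ereal \<beta> \<le> dioph_exponent L" if "0 < \<beta>" "\<beta> < \<phi> g" for \<beta>
      using that \<open>\<phi> g \<le> \<phi> \<gamma>\<close> by simp
    show ?thesis
    proof (rule ccontr)
      assume "\<not> ?thesis"
      \<comment> \<open>Such a \<open>q\<close> is positive by \<open>nonneg\<close>, so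
        \<open>*\<close> applies to it.\<close>
      then obtain q where q: "dioph_exponent L < ereal q" "ereal q < ereal (\<phi> g)"
        using ereal_dense2 by (metis not_le)
      then show False using *[of q] nonneg
        by (metis ereal_less(2) leD less_ereal.simps(1) order_le_less_trans)
    qed
  qed
  consider "\<omega> = \<infinity>" | w where "\<omega> = ereal w" "w > 0" | w where "\<omega> = ereal w" "-1 \<le> w" "w \<le> 0"
    | "\<omega> = -\<infinity>"
    using dioph_exponent_cases[of "dual_lattice L"] unfolding \<omega>_def[symmetric]
    by (cases \<omega>) (auto simp: one_ereal_def, metis not_le)
  then have "dioph_exponent L \<ge> (if \<omega> = \<infinity> then ereal (1 / b) else \<omega> / (ereal a + ereal b * \<omega>))"
  proof cases
    case 1
    \<comment> \<open>Every positive \<open>g\<close> is available here, and the bounds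
      \<open>\<phi> g\<close> tend to the required value.\<close>
    have "((\<lambda>g. \<phi> g) \<longlongrightarrow> 1 / b) at_top"
      unfolding \<phi>_def inverse_eq_divide[symmetric] using ab by real_asymp
    then have "((\<lambda>g. ereal (\<phi> g)) \<longlongrightarrow> ereal (1 / b)) at_top" by simp
    moreover have "eventually (\<lambda>g. ereal (\<phi> g) \<le> dioph_exponent L) at_top"
      using eventually_gt_at_top[of 0] by eventually_elim (simp add: phi_le 1)
    ultimately have "ereal (1 / b) \<le> dioph_exponent L"
      by (rule tendsto_upperbound) simp
    then show ?thesis using 1 by simp
  next
    case (2 w)
    have pos: "a + b * w > 0" using ab 2 by (simp add: add_pos_pos)
    then have "isCont \<phi> w" unfolding \<phi>_def by (intro continuous_intros) simp
    \<comment> \<open>Only \<open>g < w\<close> are available, hence the limit from the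
      left.\<close>
    then have "(\<phi> \<longlongrightarrow> \<phi> w) (at_left w)" by (simp add: isCont_def filterlim_at_split)
    then have "((\<lambda>g. ereal (\<phi> g)) \<longlongrightarrow> ereal (\<phi> w)) (at_left w)" by simp
    moreover have "eventually (\<lambda>g. ereal (\<phi> g) \<le> dioph_exponent L) (at_left w)"
      using 2 phi_le by (auto simp: eventually_at_left_field intro!: exI[of _ 0])
    ultimately have "ereal (\<phi> w) \<le> dioph_exponent L"
      by (rule tendsto_upperbound) simp
    then show ?thesis using 2 pos by (simp add: \<phi>_def)
  next
    case (3 w)
    \<comment> \<open>As \<open>a = b + 1\<close>, the denominator is at least 1 and the claimed
      bound is nonpositive, so \<open>nonneg\<close> suffices.\<close>
    have "b * w \<ge> b * (-1)" using 3 ab by (intro mult_left_mono) auto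
    then have "a + b * w > 0" using ab by simp
    then have "\<phi> w \<le> 0" using 3 by (simp add: \<phi>_def divide_nonpos_pos)
    then have "ereal (\<phi> w) \<le> 0" by simp
    then have "ereal (\<phi> w) \<le> dioph_exponent L" using nonneg by (rule order_trans)
    then show ?thesis using 3 \<open>a + b * w > 0\<close> by (simp add: \<phi>_def)
  next
    case 4 \<comment> \<open>here the right-hand side is the junk value \<open>-\<infinity> / -\<infinity> = 0\<close>\<close>
    then show ?thesis using ab nonneg by (simp add: divide_ereal_def)
  qed
  then show ?thesis unfolding \<omega>_def a_def b_def d_def .
qed

end
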